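(* Let $n$ be a positive integer and let $S\subseteq\{0,1\}^n$. \begin{itemize} \item If $|S|\in\{2,3\}$, then $\operatorname{ec}(\{0,1\}^n\setminus S)=n-1$. \item If $|S|=4$, then $\operatorname{ec}(\{0,1\}^n\setminus S)=n-1$ if there is a hyperplane $Q$ in $\mathbb{R}^n$ with $|Q\cap S|=3$, and $\operatorname{ec}(\{0,1\}^n\setminus S)=n-2$ otherwise. \end{itemize}
   Context: A hyperplane in $\mathbb{R}^n$ is a set $\{x\in\mathbb{R}^n : v_1x_1+\dots+v_nx_n=\alpha\}$ with $v\in\mathbb{R}^n\setminus\{0\}$ and $\alpha\in\mathbb{R}$. For $B\subseteq\{0,1\}^n$, an exact cover of $B$ is a finite set of hyperplanes whose union intersects $\{0,1\}^n$ exactly in $B$ (every point of $B$ lies on some hyperplane of the set, and no point of $\{0,1\}^n\setminus B$ lies on any of them). The exact cover number $\operatorname{ec}(B)$ is the minimum size of an exact cover of $B$. *)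

theory Defs
  imports "HOL-Analysis.Analysis"
begin

definition cube :: "(real ^ 'n) set" where
  "cube = {x. \<forall>i. x $ i \<in> {0, 1}}"

definition hyperplane :: "(real ^ 'n) set \<Rightarrow> bool" where
  "hyperplane H \<longleftrightarrow> (\<exists>v \<alpha>. v \<noteq> 0 \<and> H = {x. v \<bullet> x = \<alpha>})"

definition exact_cover :: "(real ^ 'n) set set \<Rightarrow> (real ^ 'n) set \<Rightarrow> bool" where
  "exact_cover \<H> B \<longleftrightarrow> finite \<H> \<and> (\<forall>H\<in>\<H>. hyperplane H) \<and> \<Union>\<H> \<inter> cube = B"

text \<open>
  The minimum is over a nonempty set of sizes for every \<open>B \<subseteq> cube\<close>; see
  \<open>exact_cover_exists\<close> below.
\<close>
definition ec :: "(real ^ 'n) set \<Rightarrow> nat" where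
  "ec B = (LEAST k. \<exists>\<H>. exact_cover \<H> B \<and> card \<H> = k)"

lemma finite_cube: "finite (cube :: (real ^ 'n) set)"
proof -
  have "cube \<subseteq> range (\<lambda>A. \<chi> i::'n. if i \<in> A then 1 else (0::real))"
  proof
    fix x :: "real ^ 'n" assume "x \<in> cube"
    then have "x = (\<chi> i. if i \<in> {i. x $ i = 1} then 1 else 0)"
      by (auto simp: cube_def vec_eq_iff)
    then show "x \<in> range (\<lambda>A. \<chi> i. if i \<in> A then 1 else (0::real))"
      by blast
  qed
  then show ?thesis
    by (rule finite_subset) simp
qed

lemma exact_cover_exists:
  fixes B :: "(real ^ 'n) set"
  assumes "B \<subseteq> cube"
  shows "\<exists>\<H>. exact_cover \<H> B"
proof -
  define v :: "real ^ 'n \<Rightarrow> real ^ 'n" where "v p = (\<chi> i. 2 * p $ i - 1)" for p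
  define H where "H p = {x. v p \<bullet> x = v p \<bullet> p}" for p
  have nz: "v p \<noteq> 0" if "p \<in> cube" for p
  proof
    assume "v p = 0"
    then have "v p $ undefined = 0" by simp
    moreover have "p $ undefined \<in> {0, 1}"
      using that unfolding cube_def by blast
    ultimately show False by (auto simp: v_def)
  qed
  have only: "x = p" if "p \<in> cube" "x \<in> cube" "x \<in> H p" for x p
  proof -
    have nonneg: "0 \<le> v p $ i * (p $ i - x $ i)" for i
    proof -
      have "p $ i \<in> {0, 1}" "x $ i \<in> {0, 1}"
        using that by (auto simp: cube_def)
      then show ?thesis by (auto simp: v_def)
    qed
    have "(\<Sum>i\<in>UNIV. v p $ i * (p $ i - x $ i)) = v p \<bullet> p - v p \<bullet> x"
      by (simp add: inner_vec_def right_diff_distrib sum_subtractf)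
    also have "\<dots> = 0"
      using that by (simp add: H_def)
    finally have zero: "v p $ i * (p $ i - x $ i) = 0" for i
      using nonneg by (simp add: sum_nonneg_eq_0_iff)
    have "p $ i = x $ i" for i
    proof -
      have "p $ i \<in> {0, 1}"
        using that by (auto simp: cube_def)
      then show ?thesis using zero[of i] by (auto simp: v_def)
    qed
    then show ?thesis by (simp add: vec_eq_iff)
  qed
  have "exact_cover (H ` B) B"
    unfolding exact_cover_def
  proof (intro conjI ballI)
    show "finite (H ` B)"
      using assms finite_cube finite_subset by blast
    show "hyperplane K" if "K \<in> H ` B" for K
      using that assms nz unfolding hyperplane_def H_def by blast
    show "\<Union>(H ` B) \<inter> cube = B"
      using assms only by (auto simp: H_def)
  qed
  then show ?thesis by blast
qed

end

theory Submission
  imports Defs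
begin

text \<open>
  Lower bounds: by the Alon--Fueredi argument, at least \<open>n\<close> affine functions are needed for their
  product to vanish on the cube except at exactly one point. An exact cover of the complement of
  \<open>S\<close>, together with \<open>m\<close> hyperplanes covering all but one point of \<open>S\<close>, yields such a product; here
  \<open>m = 1\<close> suffices if some hyperplane contains all but one point of \<open>S\<close>, and \<open>m = 2\<close> if \<open>S\<close> is a
  rectangle.

  Upper bounds: if a set \<open>I\<close> of coordinates separates \<open>S\<close> and determines all coordinates of the
  points of \<open>S\<close> affinely, then every coordinate outside \<open>I\<close> costs one hyperplane, which reduces the
  problem to the cube of dimension \<open>card I \<le> 3\<close>. For four points, either \<open>a + d = b + c\<close> for a suitable
  labelling, which gives \<open>n - 2\<close> and excludes hyperplanes with exactly three points, or the points
  are affinely independent, which gives \<open>n - 1\<close>.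
\<close>

section \<open>Affine functions supported on a set of coordinates, and hyperplanes as zero
  sets\<close>

text \<open>Zero \<open>v\<close> is permitted, so that constants qualify and the class is closed
  under sums and multiples.\<close>

definition affine_in :: "'n set \<Rightarrow> (real ^ 'n \<Rightarrow> real) \<Rightarrow> bool" where
  "affine_in I f \<longleftrightarrow> (\<exists>v \<beta>. (\<forall>i. i \<notin> I \<longrightarrow> v $ i = 0) \<and> f = (\<lambda>x. v \<bullet> x + \<beta>))"

lemma affine_in_const: "affine_in I (\<lambda>x. c)"
  unfolding affine_in_def by (intro exI[of _ 0] exI[of _ c]) auto

lemma axis_nth_eq_0: "i \<in> I \<Longrightarrow> j \<notin> I \<Longrightarrow> axis i c $ j = 0"
  by (auto simp: axis_def)

lemma affine_in_nth: "i \<in> I \<Longrightarrow> affine_in I (\<lambda>x. x $ i)"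
  unfolding affine_in_def
  by (intro exI[of _ "axis i 1"] exI[of _ 0]) (auto simp: inner_axis' axis_nth_eq_0 fun_eq_iff)

lemma affine_in_add:
  assumes "affine_in I f" "affine_in I g"
  shows "affine_in I (\<lambda>x. f x + g x)"
proof -
  obtain v \<beta> w \<gamma> where "\<forall>i. i \<notin> I \<longrightarrow> v $ i = 0" "f = (\<lambda>x. v \<bullet> x + \<beta>)"
    "\<forall>i. i \<notin> I \<longrightarrow> w $ i = 0" "g = (\<lambda>x. w \<bullet> x + \<gamma>)"
    using assms unfolding affine_in_def by blast
  then show ?thesis
    unfolding affine_in_def
    by (intro exI[of _ "v + w"] exI[of _ "\<beta> + \<gamma>"]) (auto simp: inner_left_distrib)
qed

lemma affine_in_mult:
  assumes "affine_in I f"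
  shows "affine_in I (\<lambda>x. c * f x)"
proof -
  obtain v \<beta> where "\<forall>i. i \<notin> I \<longrightarrow> v $ i = 0" "f = (\<lambda>x. v \<bullet> x + \<beta>)"
    using assms unfolding affine_in_def by blast
  then show ?thesis
    unfolding affine_in_def
    by (intro exI[of _ "c *\<^sub>R v"] exI[of _ "c * \<beta>"]) (auto simp: algebra_simps)
qed

lemma affine_in_diff:
  "affine_in I f \<Longrightarrow> affine_in I g \<Longrightarrow> affine_in I (\<lambda>x. f x - g x)"
  using affine_in_add[of I f "\<lambda>x. (-1) * g x"] affine_in_mult[of I g "-1"] by simp

lemmas affine_in_intros =
  affine_in_const affine_in_nth affine_in_mult affine_in_add affine_in_diff

lemma affine_in_mono: "affine_in I f \<Longrightarrow> I \<subseteq> J \<Longrightarrow> affine_in J f"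
  unfolding affine_in_def by blast

lemma affine_in_cong:
  assumes "affine_in I f" "\<And>i. i \<in> I \<Longrightarrow> x $ i = y $ i"
  shows "f x = f y"
proof -
  obtain v \<beta> where v: "\<forall>i. i \<notin> I \<longrightarrow> v $ i = 0" and f: "f = (\<lambda>x. v \<bullet> x + \<beta>)"
    using assms unfolding affine_in_def by blast
  have "v \<bullet> x = v \<bullet> y"
    unfolding inner_vec_def by (rule sum.cong) (use v assms(2) in force)+
  then show ?thesis using f by simp
qed

text \<open>A constant cannot vanish at \<open>p\<close> but not at \<open>q\<close>, so the normal
  vector is nonzero.\<close>

lemma hyperplane_zero_set:
  assumes "affine_in UNIV f" "f p = 0" "f q \<noteq> 0"
  shows "hyperplane {x. f x = 0}"
proof -
  obtain v \<beta> where f: "f = (\<lambda>x. v \<bullet> x + \<beta>)"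
    using assms unfolding affine_in_def by blast
  with assms have "v \<noteq> 0" by auto
  moreover have "{x. f x = 0} = {x. v \<bullet> x = - \<beta>}" using f by (auto simp: add_eq_0_iff)
  ultimately show ?thesis unfolding hyperplane_def by blast
qed

lemma hyperplaneE:
  assumes "hyperplane H"
  obtains f where "affine_in UNIV f" "H = {x. f x = 0}"
proof -
  obtain v \<alpha> where "H = {x. v \<bullet> x = \<alpha>}" using assms unfolding hyperplane_def by blast
  then have "H = {x. v \<bullet> x + (- \<alpha>) = 0}" by auto
  moreover have "affine_in UNIV (\<lambda>x. v \<bullet> x + (- \<alpha>))" unfolding affine_in_def by blast
  ultimately show thesis using that by blast
qed

lemma cube_nth: "x \<in> cube \<Longrightarrow> x $ i = 0 \<or> x $ i = 1"
  by (auto simp: cube_def)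

section \<open>The Alon--Fueredi bound\<close>

text \<open>A product of fewer affine functions than the dimension is, on the cube, a combination of
  monomials that each miss a variable, so it is orthogonal to the sign function
  \<open>\<Prod>i. (1 - 2 * x $ i)\<close>.\<close>

lemma sum_cube_sign_monomial:
  fixes A :: "'n::finite set"
  assumes "j \<notin> A"
  shows "(\<Sum>x\<in>cube. (\<Prod>i\<in>UNIV. 1 - 2 * x $ i) * (\<Prod>i\<in>A. x $ i)) = (0::real)"
proof -
  define h :: "real ^ 'n \<Rightarrow> real" where
    "h x = (\<Prod>i\<in>UNIV. 1 - 2 * x $ i) * (\<Prod>i\<in>A. x $ i)" for x
  \<comment> \<open>Reflecting coordinate \<open>j\<close> is an involution of the cube that negates
    the sign product and, as \<open>j \<notin> A\<close>, fixes the monomial.\<close>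
  define r :: "real ^ 'n \<Rightarrow> real ^ 'n" where
    "r x = (\<chi> i. if i = j then 1 - x $ i else x $ i)" for x
  have rr: "r (r x) = x" for x by (simp add: r_def vec_eq_iff)
  have rc: "r x \<in> cube" if "x \<in> cube" for x
    using that by (auto simp: r_def cube_def)
  have hr: "h (r x) = - h x" for x
  proof -
    have "(\<Prod>i\<in>A. r x $ i) = (\<Prod>i\<in>A. x $ i)"
      using assms by (intro prod.cong) (auto simp: r_def)
    moreover have "(\<Prod>i\<in>UNIV. 1 - 2 * r x $ i) = - (\<Prod>i\<in>UNIV. 1 - 2 * x $ i)"
    proof -
      let ?P = "\<Prod>i\<in>UNIV - {j}. 1 - 2 * x $ i"
      have "(\<Prod>i\<in>UNIV. 1 - 2 * r x $ i) = (1 - 2 * r x $ j) * (\<Prod>i\<in>UNIV - {j}. 1 - 2 * r x $ i)"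
        by (rule prod.remove) simp_all
      also have "(\<Prod>i\<in>UNIV - {j}. 1 - 2 * r x $ i) = ?P"
        by (intro prod.cong) (auto simp: r_def)
      also have "(1 - 2 * r x $ j) * ?P = - ((1 - 2 * x $ j) * ?P)"
        by (simp add: r_def algebra_simps)
      also have "(1 - 2 * x $ j) * ?P = (\<Prod>i\<in>UNIV. 1 - 2 * x $ i)"
        by (rule prod.remove[symmetric]) simp_all
      finally show ?thesis .
    qed
    ultimately show ?thesis unfolding h_def by simp
  qed
  have "sum h cube = sum (\<lambda>x. h (r x)) cube"
    by (rule sum.reindex_bij_witness[of _ r r]) (auto simp: rr rc)
  also have "\<dots> = - sum h cube" by (simp add: hr sum_negf)
  finally show ?thesis unfolding h_def by simp
qed

text \<open>Expanding one factor moves at most one new variable into the monomial over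
  \<open>A\<close>; \<open>card A + length fs\<close> does not grow, so a variable is still missing
  once the list is empty.\<close>

lemma sum_cube_sign_prod_affine:
  fixes A :: "'n::finite set"
  assumes "\<forall>f\<in>set fs. affine_in UNIV f" "card A + length fs < CARD('n)"
  shows "(\<Sum>x\<in>cube. (\<Prod>i\<in>UNIV. 1 - 2 * x $ i) * (\<Prod>i\<in>A. x $ i) * (\<Prod>f\<leftarrow>fs. f x)) = (0::real)"
  using assms
proof (induction fs arbitrary: A)
  case Nil
  then have "A \<noteq> UNIV" by auto
  then show ?case using sum_cube_sign_monomial by auto
next
  case (Cons f fs)
  define G :: "'n set \<Rightarrow> real ^ 'n \<Rightarrow> real" where
    "G A x = (\<Prod>i\<in>UNIV. 1 - 2 * x $ i) * (\<Prod>i\<in>A. x $ i) * (\<Prod>f\<leftarrow>fs. f x)" for A x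
  have IH: "sum (G B) cube = 0" if "card B + length fs < CARD('n)" for B
    using Cons.IH[of B] Cons.prems(1) that unfolding G_def by simp
  obtain v \<beta> where f: "f = (\<lambda>x. v \<bullet> x + \<beta>)"
    using Cons.prems unfolding affine_in_def by auto
  \<comment> \<open>On the cube \<open>x $ i\<close> is idempotent, so multiplying by a variable
    already in \<open>A\<close> changes nothing.\<close>
  have ins: "(\<Prod>j\<in>insert i A. x $ j) = x $ i * (\<Prod>j\<in>A. x $ j)" if "x \<in> cube" for x i
  proof (cases "i \<in> A")
    case True
    then have "(\<Prod>j\<in>A. x $ j) = x $ i * (\<Prod>j\<in>A - {i}. x $ j)"
      by (simp add: prod.remove)
    then show ?thesis using True cube_nth[OF that, of i] by (auto simp: insert_absorb)
  qed simp
  have "(\<Prod>i\<in>UNIV. 1 - 2 * x $ i) * (\<Prod>i\<in>A. x $ i) * (\<Prod>f\<leftarrow>f # fs. f x)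
      = (\<Sum>i\<in>UNIV. v $ i * G (insert i A) x) + \<beta> * G A x" if "x \<in> cube" for x
  proof -
    have "(\<Sum>i\<in>UNIV. v $ i * G (insert i A) x) = (\<Sum>i\<in>UNIV. (v $ i * x $ i) * G A x)"
      unfolding G_def using ins[OF that] by (simp add: mult_ac)
    also have "\<dots> = (v \<bullet> x) * G A x"
      by (simp add: inner_vec_def sum_distrib_right)
    finally show ?thesis by (simp add: f G_def algebra_simps)
  qed
  then have "(\<Sum>x\<in>cube. (\<Prod>i\<in>UNIV. 1 - 2 * x $ i) * (\<Prod>i\<in>A. x $ i) * (\<Prod>f\<leftarrow>f # fs. f x))
      = (\<Sum>x\<in>cube. (\<Sum>i\<in>UNIV. v $ i * G (insert i A) x) + \<beta> * G A x)"
    by (intro sum.cong) auto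
  also have "\<dots> = (\<Sum>i\<in>UNIV. v $ i * sum (G (insert i A)) cube) + \<beta> * sum (G A) cube"
    using sum.swap[of "\<lambda>x i. v $ i * G (insert i A) x" UNIV cube]
    by (simp add: sum.distrib sum_distrib_left)
  also have "\<dots> = 0"
  proof -
    have "card (insert i A) + length fs < CARD('n)" for i
      using Cons.prems(2) card_insert_le_m1[of "Suc (card A)" A i] by simp
    moreover have "card A + length fs < CARD('n)" using Cons.prems(2) by simp
    ultimately show ?thesis using IH by simp
  qed
  finally show ?case .
qed

text \<open>For a shorter list the orthogonality relation would reduce to its term at
  \<open>p\<close>, which is nonzero.\<close>

lemma alon_furedi:
  fixes p :: "real ^ 'n"
  assumes "\<forall>f\<in>set fs. affine_in UNIV f" "p \<in> cube" "\<forall>f\<in>set fs. f p \<noteq> 0"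
    and "\<And>x. x \<in> cube \<Longrightarrow> x \<noteq> p \<Longrightarrow> \<exists>f\<in>set fs. f x = 0"
  shows "CARD('n) \<le> length fs"
proof (rule ccontr)
  assume "\<not> CARD('n) \<le> length fs"
  then have "(\<Sum>x\<in>cube. (\<Prod>i\<in>UNIV. 1 - 2 * x $ i) * (\<Prod>f\<leftarrow>fs. f x)) = 0"
    using sum_cube_sign_prod_affine[OF assms(1), of "{}"] by simp
  moreover have "(\<Prod>f\<leftarrow>fs. f x) = 0" if "x \<in> cube - {p}" for x
    using assms(4)[of x] that by (auto simp: prod_list_zero_iff)
  ultimately have "(\<Prod>i\<in>UNIV. 1 - 2 * p $ i) * (\<Prod>f\<leftarrow>fs. f p) = 0"
    using sum.remove[OF finite_cube assms(2),
        of "\<lambda>x. (\<Prod>i\<in>UNIV. 1 - 2 * x $ i) * (\<Prod>f\<leftarrow>fs. f x)"] by simp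
  moreover have "1 - 2 * p $ i \<noteq> 0" for i
    using cube_nth[OF assms(2), of i] by auto
  ultimately show False using assms(3) by (auto simp: prod_list_zero_iff)
qed

section \<open>Bounding \<open>ec\<close> of a complement by lists of affine functions\<close>

text \<open>The functions of a minimum cover vanish on the cube outside \<open>S\<close>, and
  \<open>gs\<close> handles \<open>S\<close> except for \<open>p\<close>; together they meet the
  hypotheses of \<open>alon_furedi\<close>.\<close>

lemma ec_lower:
  fixes S :: "(real ^ 'n) set"
  assumes "S \<subseteq> cube" "p \<in> S" "\<forall>g\<in>set gs. affine_in UNIV g \<and> g p \<noteq> 0"
    and "\<And>s. s \<in> S \<Longrightarrow> s \<noteq> p \<Longrightarrow> \<exists>g\<in>set gs. g s = 0"
  shows "CARD('n) - length gs \<le> ec (cube - S)"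
proof -
  have "\<exists>\<H>. exact_cover \<H> (cube - S) \<and> card \<H> = ec (cube - S)"
    unfolding ec_def by (rule LeastI_ex) (use exact_cover_exists[of "cube - S"] in auto)
  then obtain \<H> where cov: "exact_cover \<H> (cube - S)" and card: "card \<H> = ec (cube - S)"
    by blast
  have "finite \<H>" using cov unfolding exact_cover_def by simp
  then obtain Hs where Hs: "set Hs = \<H>" "distinct Hs" using finite_distinct_list[of \<H>] by blast
  have "\<forall>H\<in>\<H>. \<exists>f. affine_in UNIV f \<and> H = {x. f x = 0}"
  proof
    fix H assume "H \<in> \<H>"
    then have "hyperplane H" using cov unfolding exact_cover_def by blast
    then show "\<exists>f. affine_in UNIV f \<and> H = {x. f x = 0}" by (rule hyperplaneE) blast
  qed
  then obtain F where F: "\<And>H. H \<in> \<H> \<Longrightarrow> affine_in UNIV (F H) \<and> H = {x. F H x = 0}"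
    by metis
  have zero: "(\<exists>H\<in>\<H>. F H x = 0) \<longleftrightarrow> x \<in> \<Union>\<H>" for x
    using F by blast
  have un: "\<Union>\<H> \<inter> cube = cube - S" using cov unfolding exact_cover_def by blast
  have "CARD('n) \<le> length (map F Hs @ gs)"
  proof (rule alon_furedi)
    show "\<forall>f\<in>set (map F Hs @ gs). affine_in UNIV f" using F Hs assms(3) by auto
    show "p \<in> cube" using assms by blast
    then have "p \<notin> \<Union>\<H>" using un assms(2) by blast
    then show "\<forall>f\<in>set (map F Hs @ gs). f p \<noteq> 0"
      using zero[of p] Hs assms(3) by auto
    show "\<exists>f\<in>set (map F Hs @ gs). f x = 0" if "x \<in> cube" "x \<noteq> p" for x
    proof (cases "x \<in> S")
      case True
      then show ?thesis using assms(4)[of x] that by auto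
    next
      case False
      then have "x \<in> \<Union>\<H>" using un that by blast
      then show ?thesis using zero[of x] Hs by auto
    qed
  qed
  then show ?thesis using card Hs distinct_card[of Hs] by auto
qed

text \<open>Constant functions are allowed here: a nonzero constant has an empty zero set and is
  discarded.\<close>

lemma ec_upper:
  fixes S :: "(real ^ 'n) set"
  assumes "S \<subseteq> cube" "p \<in> S" "\<forall>f\<in>set fs. affine_in UNIV f"
    and "\<And>f s. f \<in> set fs \<Longrightarrow> s \<in> S \<Longrightarrow> f s \<noteq> 0"
    and "\<And>x. x \<in> cube \<Longrightarrow> x \<notin> S \<Longrightarrow> \<exists>f\<in>set fs. f x = 0"
  shows "ec (cube - S) \<le> length fs"
proof -
  define F where "F = {f \<in> set fs. \<exists>x. f x = 0}"
  define \<H> where "\<H> = (\<lambda>f. {x. f x = 0}) ` F"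
  have "exact_cover \<H> (cube - S)"
    unfolding exact_cover_def
  proof (intro conjI ballI)
    show "finite \<H>" unfolding \<H>_def F_def by simp
    show "hyperplane H" if "H \<in> \<H>" for H
    proof -
      obtain f x where f: "f \<in> set fs" "f x = 0" "H = {x. f x = 0}"
        using \<open>H \<in> \<H>\<close> unfolding \<H>_def F_def by blast
      then show ?thesis
        using hyperplane_zero_set[of f x p] assms(2,3,4) by blast
    qed
    show "\<Union>\<H> \<inter> cube = cube - S"
      using assms(4,5) unfolding \<H>_def F_def by blast
  qed
  then have "ec (cube - S) \<le> card \<H>"
    unfolding ec_def by (intro Least_le) blast
  also have "\<dots> \<le> card F" unfolding \<H>_def by (intro card_image_le) (simp add: F_def)
  also have "\<dots> \<le> card (set fs)" unfolding F_def by (intro card_mono) auto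
  also have "\<dots> \<le> length fs" by (rule card_length)
  finally show ?thesis .
qed

text \<open>If on \<open>S\<close> a coordinate \<open>x $ k\<close> agrees with an affine function \<open>L\<close> of the coordinates in
  \<open>I\<close>, then the single hyperplane \<open>x $ k + L x = 1\<close> excludes the wrong value of \<open>x $ k\<close> above every
  point of \<open>S\<close>.\<close>

lemma ec_upper_extend:
  fixes S :: "(real ^ 'n) set"
  assumes S: "S \<subseteq> cube" "p \<in> S" and fs: "\<forall>f\<in>set fs. affine_in UNIV f"
    and nz: "\<And>f s. f \<in> set fs \<Longrightarrow> s \<in> S \<Longrightarrow> f s \<noteq> 0"
    and cov: "\<And>x. x \<in> cube \<Longrightarrow> \<forall>f\<in>set fs. f x \<noteq> 0 \<Longrightarrow> \<exists>s\<in>S. \<forall>i\<in>I. x $ i = s $ i"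
    and ext: "\<And>k. k \<notin> I \<Longrightarrow> \<exists>L. affine_in I L \<and> (\<forall>s\<in>S. L s = s $ k)"
  shows "ec (cube - S) \<le> length fs + (CARD('n) - card I)"
proof -
  obtain L where L: "\<And>k. k \<notin> I \<Longrightarrow> affine_in I (L k) \<and> (\<forall>s\<in>S. L k s = s $ k)"
    using ext by metis
  obtain ks where ks: "set ks = - I" "distinct ks"
    using finite_distinct_list[of "- I"] by auto
  define g where "g k = (\<lambda>x. x $ k + L k x - 1)" for k
  have "ec (cube - S) \<le> length (fs @ map g ks)"
  proof (rule ec_upper[OF S])
    have "affine_in UNIV (g k)" if "k \<notin> I" for k
      unfolding g_def using L[OF that] affine_in_mono[of I "L k" UNIV]
      by (intro affine_in_intros) auto
    then show "\<forall>f\<in>set (fs @ map g ks). affine_in UNIV f" using fs ks by auto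
    have "g k s \<noteq> 0" if "k \<notin> I" "s \<in> S" for k s
    proof -
      \<comment> \<open>On \<open>S\<close> the sum \<open>x $ k + L k x\<close> is twice a bit,
        hence 0 or 2 and never 1.\<close>
      have "L k s = s $ k" using L that by blast
      moreover have "s $ k = 0 \<or> s $ k = 1" using cube_nth S(1) that by blast
      ultimately show ?thesis unfolding g_def by auto
    qed
    then show "f s \<noteq> 0" if "f \<in> set (fs @ map g ks)" "s \<in> S" for f s
      using that nz ks by auto
    show "\<exists>f\<in>set (fs @ map g ks). f x = 0" if x: "x \<in> cube" "x \<notin> S" for x
    proof (cases "\<forall>f\<in>set fs. f x \<noteq> 0")
      case True
      then obtain s where s: "s \<in> S" "\<forall>i\<in>I. x $ i = s $ i" using cov x by blast
      then have "x \<noteq> s" using x by blast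
      then obtain k where k: "x $ k \<noteq> s $ k" by (auto simp: vec_eq_iff)
      then have "k \<notin> I" using s by blast
      then have "L k x = s $ k" using affine_in_cong[of I "L k" x s] L s by auto
      moreover have "x $ k + s $ k = 1"
        using k cube_nth[OF x(1), of k] cube_nth[of s k] s(1) S(1) by auto
      ultimately have "g k x = 0" unfolding g_def by simp
      then show ?thesis using \<open>k \<notin> I\<close> ks by auto
    qed auto
  qed
  moreover have "length ks = CARD('n) - card I"
    using ks distinct_card[of ks] card_Diff_subset[of I UNIV] by (simp add: Compl_eq_Diff_UNIV)
  ultimately show ?thesis by simp
qed

section \<open>Affine interpolation and reflected coordinates\<close>

text \<open>Affine functions of the coordinates in \<open>I\<close> interpolate arbitrary values on \<open>S\<close>; in other
  words, the projection to \<open>I\<close> maps \<open>S\<close> injectively onto an affinely independent set.\<close>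

definition interpolates :: "'n set \<Rightarrow> (real ^ 'n) set \<Rightarrow> bool" where
  "interpolates I S \<longleftrightarrow> (\<forall>t. \<exists>L. affine_in I L \<and> (\<forall>s\<in>S. L s = t s))"

lemma interpolatesD: "interpolates I S \<Longrightarrow> \<exists>L. affine_in I L \<and> (\<forall>s\<in>S. L s = t s)"
  unfolding interpolates_def by blast

lemma interpolates_singleton: "interpolates I {a}"
  unfolding interpolates_def
proof
  fix t :: "real ^ 'a \<Rightarrow> real"
  show "\<exists>L. affine_in I L \<and> (\<forall>s\<in>{a}. L s = t s)"
    by (intro exI[of _ "\<lambda>x. t a"]) (simp add: affine_in_const)
qed

text \<open>Newton interpolation: a multiple of \<open>w\<close> corrects the value at
  \<open>d\<close> without disturbing those on \<open>S\<close>.\<close>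

lemma interpolates_insert:
  assumes "interpolates I S" "I \<subseteq> J" "affine_in J w" "\<And>s. s \<in> S \<Longrightarrow> w s = 0" "w d \<noteq> 0"
  shows "interpolates J (insert d S)"
  unfolding interpolates_def
proof
  fix t
  obtain L where L: "affine_in I L" "\<forall>s\<in>S. L s = t s"
    using assms(1) unfolding interpolates_def by blast
  define M where "M x = L x + (t d - L d) / w d * w x" for x
  have "affine_in J M"
    unfolding M_def using affine_in_mono[OF L(1) assms(2)] assms(3)
    by (intro affine_in_intros)
  moreover have "\<forall>s\<in>insert d S. M s = t s"
    using L(2) assms(4,5) unfolding M_def by auto
  ultimately show "\<exists>L. affine_in J L \<and> (\<forall>s\<in>insert d S. L s = t s)" by blast
qed

text \<open>Reflects coordinate \<open>i\<close> where necessary so that \<open>a\<close> plays the role of the origin.\<close>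

definition flip :: "real ^ 'n \<Rightarrow> 'n \<Rightarrow> real ^ 'n \<Rightarrow> real" where
  "flip a i x = (1 - 2 * a $ i) * x $ i + a $ i"

lemma affine_in_flip: "i \<in> I \<Longrightarrow> affine_in I (flip a i)"
  unfolding flip_def by (intro affine_in_intros)

lemma flip_cube:
  assumes "a \<in> cube" "x \<in> cube"
  shows "flip a i x = (if x $ i = a $ i then 0 else 1)"
  using cube_nth[OF assms(1), of i] cube_nth[OF assms(2), of i] by (auto simp: flip_def)

lemma cube_neq_neq:
  assumes "a \<in> cube" "x \<in> cube" "y \<in> cube" "x $ i \<noteq> a $ i" "y $ i \<noteq> a $ i"
  shows "x $ i = y $ i"
  using cube_nth[OF assms(1), of i] cube_nth[OF assms(2), of i] cube_nth[OF assms(3), of i]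
    assms(4,5) by auto

lemma flip_eq_iff:
  assumes "a \<in> cube" "x \<in> cube" "y \<in> cube"
  shows "x $ i = y $ i \<longleftrightarrow> flip a i x = flip a i y"
  using cube_neq_neq[OF assms, of i] by (auto simp: flip_cube assms)

section \<open>Complements of two and three points\<close>

text \<open>A coordinate \<open>i\<close> separating the two points gives a hyperplane through
  \<open>b\<close> that misses \<open>a\<close>; taking \<open>I = {i}\<close>, only the other
  coordinates cost a hyperplane.\<close>

lemma ec_compl_2:
  fixes S :: "(real ^ 'n) set"
  assumes S: "S \<subseteq> cube" and "card S = 2"
  shows "ec (cube - S) = CARD('n) - 1"
proof -
  obtain a b where ab: "S = {a, b}" "a \<noteq> b" using assms(2) by (auto simp: card_2_iff)
  then have cu: "a \<in> cube" "b \<in> cube" using S by auto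
  obtain i where i: "a $ i \<noteq> b $ i" using ab(2) by (auto simp: vec_eq_iff)
  have "CARD('n) - length [flip b i] \<le> ec (cube - S)"
    by (rule ec_lower[of _ a]) (use S ab i cu in \<open>auto simp: flip_cube intro!: affine_in_intros affine_in_flip\<close>)
  moreover have "ec (cube - S) \<le> length ([] :: (real ^ 'n \<Rightarrow> real) list) + (CARD('n) - card {i})"
  proof (rule ec_upper_extend[of _ a])
    have "interpolates {i} (insert b {a})"
      by (rule interpolates_insert[OF interpolates_singleton[of "{i}"], of _ "flip a i"])
        (use i cu in \<open>auto simp: flip_cube intro!: affine_in_intros affine_in_flip\<close>)
    then show "\<exists>L. affine_in {i} L \<and> (\<forall>s\<in>S. L s = s $ k)" if "k \<notin> {i}" for k
      using interpolatesD[of "{i}" S "\<lambda>s. s $ k"] by (simp add: ab insert_commute)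
    show "\<exists>s\<in>S. \<forall>i\<in>{i}. x $ i = s $ i" if "x \<in> cube" for x
      using i cube_neq_neq[OF cu(1) that cu(2), of i] ab by auto
  qed (use S ab in auto)
  ultimately show ?thesis by simp
qed

text \<open>A nonconstant coordinate \<open>i\<close> splits three points two to one;
  \<open>j\<close> separates the pair, and the member of the pair that agrees with the third point
  in \<open>j\<close> is named \<open>a\<close>. Reflected at \<open>a\<close>, the points are 00,
  01, 10 in coordinates \<open>i\<close>, \<open>j\<close>.\<close>

lemma three_points:
  fixes T :: "(real ^ 'n) set"
  assumes T: "T \<subseteq> cube" and "card T = 3"
  obtains a b c i j where "T = {a, b, c}" "a \<noteq> b" "a \<noteq> c" "b \<noteq> c"
    "b $ i = a $ i" "c $ i \<noteq> a $ i" "b $ j \<noteq> a $ j" "c $ j = a $ j"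
proof -
  obtain p q r where T': "T = {p, q, r}" "p \<noteq> q" "p \<noteq> r" "q \<noteq> r"
    using assms(2) by (auto simp: card_3_iff)
  then have cu: "p \<in> cube" "q \<in> cube" "r \<in> cube" using T by auto
  obtain i where i: "p $ i \<noteq> q $ i" using T' by (auto simp: vec_eq_iff)
  have "\<exists>x y z. T = {x, y, z} \<and> x \<noteq> y \<and> x \<noteq> z \<and> y \<noteq> z \<and> y $ i = x $ i \<and> z $ i \<noteq> x $ i"
  proof (cases "r $ i = p $ i")
    case True
    then show ?thesis using T' i by - (rule exI[of _ p], rule exI[of _ r], rule exI[of _ q], auto)
  next
    case False
    then have "r $ i = q $ i" using cube_neq_neq[OF cu(1,3,2)] i by auto
    then show ?thesis using T' i by - (rule exI[of _ q], rule exI[of _ r], rule exI[of _ p], auto)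
  qed
  then obtain x y z where xyz: "T = {x, y, z}" "x \<noteq> y" "x \<noteq> z" "y \<noteq> z"
    "y $ i = x $ i" "z $ i \<noteq> x $ i" by blast
  then have cu: "x \<in> cube" "y \<in> cube" "z \<in> cube" using T by auto
  obtain j where j: "x $ j \<noteq> y $ j" using xyz by (auto simp: vec_eq_iff)
  show thesis
  proof (cases "z $ j = x $ j")
    case True
    then show thesis using that[of x y z i j] xyz j by auto
  next
    case False
    then have "z $ j = y $ j" using cube_neq_neq[OF cu(1,3,2), of j] j by auto
    then show thesis using that[of y x z i j] xyz j by auto
  qed
qed

lemma interpolates_three:
  assumes "a \<in> cube" "b \<in> cube" "c \<in> cube"
    and "b $ i = a $ i" "c $ i \<noteq> a $ i" "b $ j \<noteq> a $ j" "c $ j = a $ j"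
  shows "interpolates {i, j} {a, b, c}"
proof -
  have "interpolates {j} (insert b {a})"
    by (rule interpolates_insert[OF interpolates_singleton[of "{j}"], of _ "flip a j"])
      (use assms in \<open>auto simp: flip_cube intro!: affine_in_intros affine_in_flip\<close>)
  then have "interpolates {i, j} (insert c (insert b {a}))"
    by (rule interpolates_insert[where w = "flip a i"])
      (use assms in \<open>auto simp: flip_cube intro!: affine_in_intros affine_in_flip\<close>)
  then show ?thesis by (simp add: insert_commute)
qed

text \<open>The hyperplane \<open>flip a i x = 0\<close> contains \<open>a\<close> and
  \<open>b\<close> but not \<open>c\<close>. For the upper bound, the projection to
  \<open>i\<close>, \<open>j\<close> omits only the corner 11, which one hyperplane removes.\<close>

lemma ec_compl_3:
  fixes S :: "(real ^ 'n) set"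
  assumes S: "S \<subseteq> cube" and "card S = 3"
  shows "ec (cube - S) = CARD('n) - 1"
proof -
  obtain a b c i j where abc: "S = {a, b, c}" "a \<noteq> b" "a \<noteq> c" "b \<noteq> c"
    and ij: "b $ i = a $ i" "c $ i \<noteq> a $ i" "b $ j \<noteq> a $ j" "c $ j = a $ j"
    by (rule three_points[OF assms])
  then have cu: "a \<in> cube" "b \<in> cube" "c \<in> cube" using S by auto
  have "i \<noteq> j" using ij by auto
  have "CARD('n) - length [flip a i] \<le> ec (cube - S)"
    by (rule ec_lower[of _ c]) (use S abc ij cu in \<open>auto simp: flip_cube intro!: affine_in_intros affine_in_flip\<close>)
  moreover have "ec (cube - S) \<le> length [\<lambda>x. flip a i x + flip a j x - 2] + (CARD('n) - card {i, j})"
  proof (rule ec_upper_extend[of _ a])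
    show "\<exists>L. affine_in {i, j} L \<and> (\<forall>s\<in>S. L s = s $ k)" for k
      using interpolatesD[OF interpolates_three[OF cu ij], of "\<lambda>s. s $ k"] by (simp add: abc)
    show "\<exists>s\<in>S. \<forall>i\<in>{i, j}. x $ i = s $ i"
      if "x \<in> cube" "\<forall>f\<in>set [\<lambda>x. flip a i x + flip a j x - 2]. f x \<noteq> 0" for x
      using that(2) ij cube_neq_neq[OF cu(1) that(1) cu(2), of j]
        cube_neq_neq[OF cu(1) that(1) cu(3), of i]
      by (auto simp: abc flip_cube cu that(1) split: if_splits)
  qed (use S abc cu ij in \<open>auto simp: flip_cube intro!: affine_in_intros affine_in_flip\<close>)
  \<comment> \<open>Guards against truncated subtraction: \<open>1 + (CARD('n) - 2)\<close> must
    equal \<open>CARD('n) - 1\<close>.\<close>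
  moreover have "CARD('n) \<ge> card {i, j}" by (intro card_mono) auto
  ultimately show ?thesis using \<open>i \<noteq> j\<close> by simp
qed

section \<open>Bounds for complements of four points, by configuration\<close>

text \<open>Coordinate \<open>k\<close> lifts \<open>d\<close> off the other three points, so the
  projection to \<open>i\<close>, \<open>j\<close>, \<open>k\<close> is affinely
  independent.\<close>

lemma ec_compl_4_isolated:
  fixes S :: "(real ^ 'n) set"
  assumes S: "S \<subseteq> cube" and "card S = 4" and d: "d \<in> S" "\<And>s. s \<in> S \<Longrightarrow> s \<noteq> d \<Longrightarrow> s $ k \<noteq> d $ k"
  shows "ec (cube - S) \<le> CARD('n) - 1"
proof -
  have "S - {d} \<subseteq> cube" using S by blast
  moreover have "card (S - {d}) = 3" using assms(2) d(1) by (simp add: card_Diff_singleton)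
  ultimately obtain a b c i j where abc: "S - {d} = {a, b, c}" "a \<noteq> b" "a \<noteq> c" "b \<noteq> c"
    and ij: "b $ i = a $ i" "c $ i \<noteq> a $ i" "b $ j \<noteq> a $ j" "c $ j = a $ j"
    by (rule three_points)
  have S': "S = {a, b, c, d}" using abc(1) d(1) by blast
  have dn: "a \<noteq> d" "b \<noteq> d" "c \<noteq> d" using abc(1) by auto
  have cu: "a \<in> cube" "b \<in> cube" "c \<in> cube" "d \<in> cube" using S S' by auto
  have k: "d $ k \<noteq> a $ k" "b $ k = a $ k" "c $ k = a $ k"
    using d(2)[of a] d(2)[of b] d(2)[of c] dn S'
      cube_neq_neq[OF cu(4,2,1), of k] cube_neq_neq[OF cu(4,3,1), of k] by auto
  have ne: "i \<noteq> j" "i \<noteq> k" "j \<noteq> k" using ij k by auto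
  have "interpolates {i, j, k} (insert d {a, b, c})"
    by (rule interpolates_insert[OF interpolates_three[OF cu(1-3) ij], of _ "flip a k"])
      (use k cu in \<open>auto simp: flip_cube intro!: affine_in_intros affine_in_flip\<close>)
  moreover have "S = insert d {a, b, c}" using S' by blast
  ultimately have int: "\<exists>L. affine_in {i, j, k} L \<and> (\<forall>s\<in>S. L s = s $ l)" for l
    using interpolatesD[of "{i, j, k}" S "\<lambda>s. s $ l"] by simp
  let ?u = "flip a i" and ?v = "flip a j" and ?w = "flip a k"
  have u01: "?u x = 0 \<or> ?u x = 1" "?v x = 0 \<or> ?v x = 1" "?w x = 0 \<or> ?w x = 1" if "x \<in> cube" for x
    using that cu by (auto simp: flip_cube)
  have val: "?u a = 0" "?v a = 0" "?w a = 0" "?u b = 0" "?v b = 1" "?w b = 0"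
    "?u c = 1" "?v c = 0" "?w c = 0" "?w d = 1"
    using ij k cu by (auto simp: flip_cube)
  \<comment> \<open>Two planes in three coordinates suffice, as 2 + (n - 3) = n - 1.\<close>
  have bound: ?thesis
    if fg: "affine_in UNIV f" "affine_in UNIV g" "\<forall>s\<in>S. f s \<noteq> 0 \<and> g s \<noteq> 0"
      and cov: "\<And>x. x \<in> cube \<Longrightarrow> f x \<noteq> 0 \<Longrightarrow> g x \<noteq> 0 \<Longrightarrow>
        \<exists>s\<in>S. ?u x = ?u s \<and> ?v x = ?v s \<and> ?w x = ?w s" for f g
  proof -
    have "ec (cube - S) \<le> length [f, g] + (CARD('n) - card {i, j, k})"
    proof (rule ec_upper_extend[OF S d(1) _ _ _ int])
      fix x :: "real ^ 'n"
      assume x: "x \<in> cube" "\<forall>f\<in>set [f, g]. f x \<noteq> 0"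
      then obtain s where s: "s \<in> S" "?u x = ?u s" "?v x = ?v s" "?w x = ?w s"
        using cov[of x] by auto
      moreover have "s \<in> cube" using S s(1) by blast
      ultimately show "\<exists>s\<in>S. \<forall>i\<in>{i, j, k}. x $ i = s $ i"
        using flip_eq_iff[OF cu(1) x(1), of s] by (intro bexI[of _ s]) simp_all
    qed (use fg in auto)
    moreover have "CARD('n) \<ge> card {i, j, k}" by (intro card_mono) auto
    ultimately show ?thesis using ne by simp
  qed
  text \<open>In the coordinates \<open>?u, ?v, ?w\<close> the set \<open>S\<close> is 000, 010, 100 together with a point \<open>d\<close> of the
    upper face; its complement in the three-dimensional cube needs two planes.\<close>
  consider "?u d = 0" "?v d = 0" | "?u d = 1" "?v d = 0" | "?u d = 0" "?v d = 1"
    | "?u d = 1" "?v d = 1" using u01[OF cu(4)] by blast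
  then show ?thesis
  proof cases
    case 1
    \<comment> \<open>Here \<open>d\<close> is 001: the first plane takes 110 and 111, the second
      101 and 011.\<close>
    show ?thesis
    proof (rule bound[of "\<lambda>x. ?u x + ?v x - 2" "\<lambda>x. ?u x + ?v x + ?w x - 2"])
      fix x
      assume x: "x \<in> cube" and "?u x + ?v x - 2 \<noteq> 0" "?u x + ?v x + ?w x - 2 \<noteq> 0"
      then show "\<exists>s\<in>S. ?u x = ?u s \<and> ?v x = ?v s \<and> ?w x = ?w s"
        using u01[OF x] val 1 by (elim disjE) (simp_all add: S')
    qed (use val 1 in \<open>auto simp: S' intro!: affine_in_intros affine_in_flip\<close>)
  next
    case 2
    \<comment> \<open>Here \<open>d\<close> is 101: the second plane takes 001 and 011. The next
      case swaps the roles of \<open>?u\<close> and \<open>?v\<close>.\<close>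
    show ?thesis
    proof (rule bound[of "\<lambda>x. ?u x + ?v x - 2" "\<lambda>x. ?w x - ?u x - 1"])
      fix x
      assume x: "x \<in> cube" and "?u x + ?v x - 2 \<noteq> 0" "?w x - ?u x - 1 \<noteq> 0"
      then show "\<exists>s\<in>S. ?u x = ?u s \<and> ?v x = ?v s \<and> ?w x = ?w s"
        using u01[OF x] val 2 by (elim disjE) (simp_all add: S')
    qed (use val 2 in \<open>auto simp: S' intro!: affine_in_intros affine_in_flip\<close>)
  next
    case 3
    show ?thesis
    proof (rule bound[of "\<lambda>x. ?u x + ?v x - 2" "\<lambda>x. ?w x - ?v x - 1"])
      fix x
      assume x: "x \<in> cube" and "?u x + ?v x - 2 \<noteq> 0" "?w x - ?v x - 1 \<noteq> 0"
      then show "\<exists>s\<in>S. ?u x = ?u s \<and> ?v x = ?v s \<and> ?w x = ?w s"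
        using u01[OF x] val 3 by (elim disjE) (simp_all add: S')
    qed (use val 3 in \<open>auto simp: S' intro!: affine_in_intros affine_in_flip\<close>)
  next
    case 4
    \<comment> \<open>Here \<open>d\<close> is 111: the first plane takes the three points of weight
      two, the second 001.\<close>
    show ?thesis
    proof (rule bound[of "\<lambda>x. ?u x + ?v x + ?w x - 2" "\<lambda>x. ?w x - ?u x - ?v x - 1"])
      fix x
      assume x: "x \<in> cube" and "?u x + ?v x + ?w x - 2 \<noteq> 0" "?w x - ?u x - ?v x - 1 \<noteq> 0"
      then show "\<exists>s\<in>S. ?u x = ?u s \<and> ?v x = ?v s \<and> ?w x = ?w s"
        using u01[OF x] val 4 by (elim disjE) (simp_all add: S')
    qed (use val 4 in \<open>auto simp: S' intro!: affine_in_intros affine_in_flip\<close>)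
  qed
qed

text \<open>In the reflected coordinates \<open>S\<close> becomes the even-weight vertices 000, 011,
  101, 110; the odd ones have coordinate sum 1 or 3.\<close>

lemma ec_compl_4_tetrahedron:
  fixes S :: "(real ^ 'n) set"
  assumes S: "S \<subseteq> cube" "S = {a, b, c, d}"
    and i: "b $ i = a $ i" "c $ i \<noteq> a $ i" "d $ i \<noteq> a $ i"
    and j: "b $ j \<noteq> a $ j" "c $ j = a $ j" "d $ j \<noteq> a $ j"
    and k: "b $ k \<noteq> a $ k" "c $ k \<noteq> a $ k" "d $ k = a $ k"
  shows "ec (cube - S) \<le> CARD('n) - 1"
proof -
  have cu: "a \<in> cube" "b \<in> cube" "c \<in> cube" "d \<in> cube" using S by auto
  have ne: "i \<noteq> j" "i \<noteq> k" "j \<noteq> k" using i j k by auto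
  let ?u = "flip a i" and ?v = "flip a j" and ?w = "flip a k"
  have u01: "?u x = 0 \<or> ?u x = 1" "?v x = 0 \<or> ?v x = 1" "?w x = 0 \<or> ?w x = 1" if "x \<in> cube" for x
    using that cu by (auto simp: flip_cube)
  have val: "?u a = 0" "?v a = 0" "?w a = 0" "?u b = 0" "?v b = 1" "?w b = 1"
    "?u c = 1" "?v c = 0" "?w c = 1" "?u d = 1" "?v d = 1" "?w d = 0"
    using i j k cu by (auto simp: flip_cube)
  have "interpolates {i, j, k} (insert d {a, b, c})"
    \<comment> \<open>The plane \<open>?w = ?u + ?v\<close> passes through 000, 011, 101 and misses
      110.\<close>
    by (rule interpolates_insert[OF interpolates_three[OF cu(1-3)], of i j _ "\<lambda>x. ?w x - ?u x - ?v x"])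
      (use i j val in \<open>auto intro!: affine_in_intros affine_in_flip\<close>)
  moreover have "S = insert d {a, b, c}" using S(2) by blast
  ultimately have int: "\<exists>L. affine_in {i, j, k} L \<and> (\<forall>s\<in>S. L s = s $ l)" for l
    using interpolatesD[of "{i, j, k}" S "\<lambda>s. s $ l"] by simp
  let ?fs = "[\<lambda>x. ?u x + ?v x + ?w x - 1, \<lambda>x. ?u x + ?v x + ?w x - 3]"
  have "ec (cube - S) \<le> length ?fs + (CARD('n) - card {i, j, k})"
  proof (rule ec_upper_extend[OF S(1) _ _ _ _ int])
    show "a \<in> S" using S by simp
    show "\<forall>f\<in>set ?fs. affine_in UNIV f" by (auto intro!: affine_in_intros affine_in_flip)
    show "f s \<noteq> 0" if "f \<in> set ?fs" "s \<in> S" for f s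
      using that val by (auto simp: S)
    fix x :: "real ^ 'n"
    assume x: "x \<in> cube" "\<forall>f\<in>set ?fs. f x \<noteq> 0"
    then have "\<exists>s\<in>S. ?u x = ?u s \<and> ?v x = ?v s \<and> ?w x = ?w s"
      using u01[OF x(1)] val by (elim disjE) (simp_all add: S(2))
    then show "\<exists>s\<in>S. \<forall>i\<in>{i, j, k}. x $ i = s $ i"
      using flip_eq_iff[OF cu(1) x(1)] S by blast
  qed
  moreover have "CARD('n) \<ge> card {i, j, k}" by (intro card_mono) auto
  ultimately show ?thesis using ne by simp
qed

text \<open>The projection to \<open>i\<close>, \<open>j\<close> is the whole square, so no further
  plane is needed. Conversely, \<open>?u = 1\<close> and \<open>?v = 1\<close> cover
  \<open>b\<close>, \<open>c\<close>, \<open>d\<close> and miss \<open>a\<close>.\<close>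

lemma ec_compl_4_rectangle:
  fixes S :: "(real ^ 'n) set"
  assumes S: "S \<subseteq> cube" "S = {a, b, c, d}"
    and i: "b $ i = a $ i" "c $ i \<noteq> a $ i" "d $ i \<noteq> a $ i"
    and j: "b $ j \<noteq> a $ j" "c $ j = a $ j" "d $ j \<noteq> a $ j"
    and sum: "a + d = b + c"
  shows "ec (cube - S) = CARD('n) - 2"
proof -
  have cu: "a \<in> cube" "b \<in> cube" "c \<in> cube" "d \<in> cube" using S by auto
  have "i \<noteq> j" using i j by auto
  let ?u = "flip a i" and ?v = "flip a j"
  have u01: "?u x = 0 \<or> ?u x = 1" "?v x = 0 \<or> ?v x = 1" if "x \<in> cube" for x
    using that cu by (auto simp: flip_cube)
  have val: "?u a = 0" "?v a = 0" "?u b = 0" "?v b = 1" "?u c = 1" "?v c = 0" "?u d = 1" "?v d = 1"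
    using i j cu by (auto simp: flip_cube)
  have "CARD('n) - length [\<lambda>x. ?u x - 1, \<lambda>x. ?v x - 1] \<le> ec (cube - S)"
    by (rule ec_lower[of _ a]) (use S val in \<open>auto intro!: affine_in_intros affine_in_flip\<close>)
  moreover have "ec (cube - S) \<le> length ([] :: (real ^ 'n \<Rightarrow> real) list) + (CARD('n) - card {i, j})"
  proof (rule ec_upper_extend[of _ a])
    fix l
    define L where "L x = a $ l + (b $ l - a $ l) * ?v x + (c $ l - a $ l) * ?u x" for x
    have "d $ l = b $ l + c $ l - a $ l"
      using arg_cong[OF sum, of "\<lambda>x. x $ l"] by simp
    then have "\<forall>s\<in>S. L s = s $ l" using val by (simp add: S L_def)
    moreover have "affine_in {i, j} L" unfolding L_def
      by (intro affine_in_intros affine_in_flip) auto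
    ultimately show "\<exists>L. affine_in {i, j} L \<and> (\<forall>s\<in>S. L s = s $ l)" by blast
  next
    fix x :: "real ^ 'n"
    assume x: "x \<in> cube"
    then have "\<exists>s\<in>S. ?u x = ?u s \<and> ?v x = ?v s"
      using u01[OF x] val by (elim disjE) (simp_all add: S(2))
    then show "\<exists>s\<in>S. \<forall>i\<in>{i, j}. x $ i = s $ i"
      using flip_eq_iff[OF cu(1) x] S by blast
  qed (use S in auto)
  ultimately show ?thesis using \<open>i \<noteq> j\<close> by simp
qed

section \<open>Hyperplanes through three of four points, and the case distinction\<close>

text \<open>The relation \<open>a + d = b + c\<close> passes to values of
  \<open>v \<bullet> x\<close>, so three points on \<open>Q\<close> force the fourth onto
  it.\<close>

lemma no_hyperplane_rectangle:
  assumes "card {a, b, c, d} = 4" "a + d = b + c" "hyperplane Q"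
  shows "card (Q \<inter> {a, b, c, d}) \<noteq> 3"
proof
  assume c3: "card (Q \<inter> {a, b, c, d}) = 3"
  obtain v \<alpha> where Q: "Q = {x. v \<bullet> x = \<alpha>}" using assms(3) unfolding hyperplane_def by blast
  have e: "v \<bullet> a + v \<bullet> d = v \<bullet> b + v \<bullet> c"
    using assms(2) by (metis inner_right_distrib)
  have "card ({a, b, c, d} - Q) = 1"
    using card_Diff_subset_Int[of "{a, b, c, d}" Q] assms(1) c3 by (simp add: Int_commute)
  then obtain p where "{a, b, c, d} - Q = {p}" by (auto simp: card_1_singleton_iff)
  moreover have ne: "a \<noteq> b" "a \<noteq> c" "a \<noteq> d" "b \<noteq> c" "b \<noteq> d" "c \<noteq> d"
    using assms(1) by (auto simp: card_insert_if split: if_splits)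
  ultimately have "p \<notin> Q" "p \<in> {a, b, c, d}" "\<forall>x\<in>{a, b, c, d}. x \<noteq> p \<longrightarrow> x \<in> Q" by blast+
  then show False using e ne Q by auto
qed

lemma ec_compl_4_lower:
  fixes S :: "(real ^ 'n) set"
  assumes S: "S \<subseteq> cube" and "card S = 4" and Q: "hyperplane Q" "card (Q \<inter> S) = 3"
  shows "CARD('n) - 1 \<le> ec (cube - S)"
proof -
  have "finite S" using S finite_cube finite_subset by blast
  then have "card (S - Q) = 1"
    using card_Diff_subset_Int[of S Q] assms(2) Q(2) by (simp add: Int_commute)
  then obtain p where p: "S - Q = {p}" by (auto simp: card_1_singleton_iff)
  obtain f where f: "affine_in UNIV f" "Q = {x. f x = 0}" using hyperplaneE[OF Q(1)] .
  have "CARD('n) - length [f] \<le> ec (cube - S)"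
    by (rule ec_lower[of _ p]) (use S p f in auto)
  then show ?thesis by simp
qed

lemma hyperplane_three_points:
  assumes "card S = 4" "d \<in> S" "affine_in UNIV f" "f d \<noteq> 0"
    and "\<And>s. s \<in> S \<Longrightarrow> s \<noteq> d \<Longrightarrow> f s = 0"
  shows "\<exists>Q. hyperplane Q \<and> card (Q \<inter> S) = 3"
proof -
  have c: "card (S - {d}) = 3" using assms(1,2) by (simp add: card_Diff_singleton)
  then have "S - {d} \<noteq> {}" by force
  then obtain s where "s \<in> S" "s \<noteq> d" by blast
  then have "hyperplane {x. f x = 0}"
    using hyperplane_zero_set[of f s d] assms(3-5) by blast
  moreover have "{x. f x = 0} \<inter> S = S - {d}" using assms(4,5) by blast
  ultimately show ?thesis using c by metis
qed

text \<open>By \<open>no\<close>, every nonconstant coordinate splits \<open>S\<close> two to two.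
  Choosing \<open>j\<close> first and then \<open>i\<close> separating \<open>a\<close> from its
  partner in \<open>j\<close> puts the points at the four corners of a square.\<close>

lemma four_points_even:
  fixes S :: "(real ^ 'n) set"
  assumes S: "S \<subseteq> cube" and "card S = 4"
    and no: "\<And>k d. d \<in> S \<Longrightarrow> \<exists>s\<in>S. s \<noteq> d \<and> s $ k = d $ k"
  obtains a b c d i j where "S = {a, b, c, d}"
    "b $ i = a $ i" "c $ i \<noteq> a $ i" "d $ i \<noteq> a $ i"
    "b $ j \<noteq> a $ j" "c $ j = a $ j" "d $ j \<noteq> a $ j"
proof -
  have "S \<noteq> {}" using assms(2) by auto
  then obtain a where a: "a \<in> S" by blast
  have "card (S - {a}) = 3" using assms(2) a by (simp add: card_Diff_singleton)
  then obtain p q r where "S - {a} = {p, q, r}" and ne: "p \<noteq> q" "p \<noteq> r" "q \<noteq> r"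
    by (auto simp: card_3_iff)
  then have S': "S = {a, p, q, r}" and nea: "a \<noteq> p" "a \<noteq> q" "a \<noteq> r"
    using a by blast+
  obtain j where j: "a $ j \<noteq> p $ j" using nea by (auto simp: vec_eq_iff)
  have cu: "a \<in> cube" "p \<in> cube" "q \<in> cube" "r \<in> cube" using S S' by auto
  have "\<exists>c e. S = {a, p, c, e} \<and> p \<noteq> c \<and> p \<noteq> e \<and> c \<noteq> e \<and> a \<noteq> c \<and> a \<noteq> e \<and>
    c $ j = a $ j \<and> e $ j \<noteq> a $ j"
  proof -
    have "\<exists>s\<in>S. s \<noteq> a \<and> s $ j = a $ j" "\<exists>s\<in>S. s \<noteq> p \<and> s $ j = p $ j"
      using no S' by blast+
    then consider "q $ j = a $ j" "r $ j \<noteq> a $ j" | "r $ j = a $ j" "q $ j \<noteq> a $ j"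
      using j S' ne by auto
    then show ?thesis
    proof cases
      case 1
      then show ?thesis using S' ne nea by metis
    next
      case 2
      moreover have "S = {a, p, r, q}" using S' by blast
      ultimately show ?thesis using ne nea by metis
    qed
  qed
  then obtain c e where S2: "S = {a, p, c, e}"
    and ne2: "p \<noteq> c" "p \<noteq> e" "c \<noteq> e" "a \<noteq> c" "a \<noteq> e"
    and j2: "c $ j = a $ j" "e $ j \<noteq> a $ j" by blast
  obtain i where i: "a $ i \<noteq> c $ i" using ne2 by (auto simp: vec_eq_iff)
  have "\<exists>s\<in>S. s \<noteq> a \<and> s $ i = a $ i" "\<exists>s\<in>S. s \<noteq> c \<and> s $ i = c $ i"
    using no S2 by blast+
  \<comment> \<open>The partner of \<open>a\<close> in coordinate \<open>i\<close> takes the role of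
    \<open>b\<close>.\<close>
  then consider "p $ i = a $ i" "e $ i \<noteq> a $ i" | "e $ i = a $ i" "p $ i \<noteq> a $ i"
    using i S2 ne2 by auto
  then show thesis
  proof cases
    case 1
    then show thesis using that[of a p c e i j] S2 i j j2 by auto
  next
    case 2
    then show thesis using that[of a e c p i j] S2 i j j2 by auto
  qed
qed

text \<open>If no coordinate isolates a point, only the diagonal split of \<open>a\<close>,
  \<open>d\<close> from \<open>b\<close>, \<open>c\<close> violates \<open>a + d = b + c\<close>; it
  yields the tetrahedron, and its absence the rectangle.\<close>

lemma ec_compl_4_cases:
  fixes S :: "(real ^ 'n) set"
  assumes S: "S \<subseteq> cube" and card: "card S = 4"
  shows "(\<exists>Q. hyperplane Q \<and> card (Q \<inter> S) = 3) \<and> ec (cube - S) \<le> CARD('n) - 1 \<or>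
    (\<nexists>Q. hyperplane Q \<and> card (Q \<inter> S) = 3) \<and> ec (cube - S) = CARD('n) - 2"
proof (cases "\<exists>k d. d \<in> S \<and> (\<forall>s\<in>S. s \<noteq> d \<longrightarrow> s $ k \<noteq> d $ k)")
  case True
  then obtain k d where d: "d \<in> S" "\<And>s. s \<in> S \<Longrightarrow> s \<noteq> d \<Longrightarrow> s $ k \<noteq> d $ k" by blast
  have "\<exists>Q. hyperplane Q \<and> card (Q \<inter> S) = 3"
    by (rule hyperplane_three_points[OF card d(1), of "\<lambda>x. flip d k x - 1"])
      (use d S in \<open>auto simp: flip_cube subset_iff intro!: affine_in_intros affine_in_flip\<close>)
  then show ?thesis using ec_compl_4_isolated[OF S card d] by blast
next
  case False
  then have even: "\<And>k d. d \<in> S \<Longrightarrow> \<exists>s\<in>S. s \<noteq> d \<and> s $ k = d $ k" by blast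
  obtain a b c d i j where S': "S = {a, b, c, d}"
    and i: "b $ i = a $ i" "c $ i \<noteq> a $ i" "d $ i \<noteq> a $ i"
    and j: "b $ j \<noteq> a $ j" "c $ j = a $ j" "d $ j \<noteq> a $ j"
    by (rule four_points_even[OF S card even])
  have cu: "a \<in> cube" "b \<in> cube" "c \<in> cube" "d \<in> cube" using S S' by auto
  show ?thesis
  proof (cases "\<exists>k. b $ k \<noteq> a $ k \<and> c $ k \<noteq> a $ k \<and> d $ k = a $ k")
    case True
    then obtain k where k: "b $ k \<noteq> a $ k" "c $ k \<noteq> a $ k" "d $ k = a $ k" by blast
    have "\<exists>Q. hyperplane Q \<and> card (Q \<inter> S) = 3"
      \<comment> \<open>Each of \<open>b\<close>, \<open>c\<close>, \<open>d\<close> differs from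
        \<open>a\<close> in exactly two of the three coordinates, so this function vanishes there
        and is -2 at \<open>a\<close>.\<close>
      by (rule hyperplane_three_points[OF card, of a
            "\<lambda>x. flip a i x + flip a j x + flip a k x - 2"])
        (use i j k cu S' in \<open>auto simp: flip_cube intro!: affine_in_intros affine_in_flip\<close>)
    then show ?thesis using ec_compl_4_tetrahedron[OF S S' i j k] by blast
  next
    case no3: False
    have "a $ k + d $ k = b $ k + c $ k" for k
    proof -
      \<comment> \<open>The first four facts say that no point is isolated in \<open>k\<close>; the
        last excludes the diagonal split.\<close>
      have parity: "b $ k = a $ k \<or> c $ k = a $ k \<or> d $ k = a $ k"
        "a $ k = b $ k \<or> c $ k = b $ k \<or> d $ k = b $ k"
        "a $ k = c $ k \<or> b $ k = c $ k \<or> d $ k = c $ k"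
        "a $ k = d $ k \<or> b $ k = d $ k \<or> c $ k = d $ k"
        "b $ k = a $ k \<or> c $ k = a $ k \<or> d $ k \<noteq> a $ k"
        using even[of a k] even[of b k] even[of c k] even[of d k] no3 S' by blast+
      show ?thesis
        using cube_nth[OF cu(1), of k] cube_nth[OF cu(2), of k]
          cube_nth[OF cu(3), of k] cube_nth[OF cu(4), of k]
        by (elim disjE) (use parity in simp_all)
    qed
    then have sum: "a + d = b + c" by (simp add: vec_eq_iff)
    then have "\<nexists>Q. hyperplane Q \<and> card (Q \<inter> S) = 3"
      using no_hyperplane_rectangle[of a b c d] card S' by auto
    then show ?thesis using ec_compl_4_rectangle[OF S S' i j sum] by blast
  qed
qed

theorem theorem1:
  fixes S :: "(real ^ 'n) set"
  assumes "S \<subseteq> cube"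
  shows "(card S \<in> {2, 3} \<longrightarrow> ec (cube - S) = CARD('n) - 1) \<and>
    (card S = 4 \<longrightarrow>
      ec (cube - S) =
        (if \<exists>Q. hyperplane Q \<and> card (Q \<inter> S) = 3 then CARD('n) - 1 else CARD('n) - 2))"
proof (intro conjI impI)
  show "ec (cube - S) = CARD('n) - 1" if "card S \<in> {2, 3}"
    using that ec_compl_2[OF assms] ec_compl_3[OF assms] by blast
  show "ec (cube - S) =
    (if \<exists>Q. hyperplane Q \<and> card (Q \<inter> S) = 3 then CARD('n) - 1 else CARD('n) - 2)"
    if "card S = 4"
  proof (cases "\<exists>Q. hyperplane Q \<and> card (Q \<inter> S) = 3")
    case True
    then have "CARD('n) - 1 \<le> ec (cube - S)" using ec_compl_4_lower[OF assms that] by blast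
    moreover have "ec (cube - S) \<le> CARD('n) - 1" using True ec_compl_4_cases[OF assms that] by blast
    ultimately show ?thesis using True by simp
  next
    case False
    then show ?thesis using ec_compl_4_cases[OF assms that] by (simp only: if_False) blast
  qed
qed

end
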